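(* Let $n\ge1$, let $K$ be a convex body in $\mathbb{R}^n$, $B$ an ellipsoid in $\mathbb{R}^n$ and $Z$ a zonoid in $\mathbb{R}^n$. Then $$|B|\,|B+K+Z|\le|B+K|\,|B+Z|.$$
   Context: $|\cdot|$ is $n$-dimensional volume and $+$ is Minkowski addition. A convex body is a compact convex set with nonempty interior. A zonotope is a Minkowski sum of finitely many line segments; a zonoid is a limit of zonotopes in the Hausdorff metric. An ellipsoid is an affine image of the Euclidean unit ball. *)

theory Defs
  imports "HOL-Analysis.Analysis"
begin

text \<open>Minkowski addition of sets is the pointwise sum A + B from HOL-Library.Set_Algebras
(imported by HOL-Analysis); volume is Lebesgue measure.\<close>

definition convex_body :: "'a::euclidean_space set \<Rightarrow> bool" where
  "convex_body K \<longleftrightarrow> compact K \<and> convex K \<and> interior K \<noteq> {}"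

definition ellipsoid :: "'a::euclidean_space set \<Rightarrow> bool" where
  "ellipsoid B \<longleftrightarrow> (\<exists>T c. linear T \<and> B = (\<lambda>x. T x + c) ` cball (0::'a) 1)"

definition zonotope :: "'a::euclidean_space set \<Rightarrow> bool" where
  "zonotope Z \<longleftrightarrow> (\<exists>(I::nat set) a b. finite I \<and> Z = (\<Sum>i\<in>I. closed_segment (a i) (b i)))"

definition hausdorff_distance :: "'a::metric_space set \<Rightarrow> 'a set \<Rightarrow> real" where
  "hausdorff_distance A B = max (SUP a\<in>A. infdist a B) (SUP b\<in>B. infdist b A)"

definition zonoid :: "'a::euclidean_space set \<Rightarrow> bool" where
  "zonoid Z \<longleftrightarrow> compact Z \<and> Z \<noteq> {} \<and>
     (\<exists>Zs :: nat \<Rightarrow> 'a set. (\<forall>k. zonotope (Zs k)) \<and>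
        (\<lambda>k. hausdorff_distance (Zs k) Z) \<longlonglongrightarrow> 0)"

end

theory Submission
  imports Defs
begin

text \<open>After a linear change of variables \<open>B\<close> is the unit ball, and by compactness it is enough to treat
  zonotopes. If \<open>P\<close> is the orthogonal projection along a unit vector \<open>w\<close>, then
  \<open>|X + [0, s w]| = |X| + s |P X|\<close> for convex \<open>X\<close>, so adding the segments one at a time expands
  \<open>|B + K + Z|\<close> and \<open>|B + Z|\<close> into nonnegative combinations, with the same coefficients, of
  projection volumes \<open>|P (B + K)|\<close> and \<open>|P B|\<close>. It remains to see
  \<open>|P (B + K)| / |P B| \<le> |B + K| / |B|\<close>, one direction \<open>w\<close> at a time. Replacing \<open>K\<close> by \<open>P K\<close> does
  not increase \<open>|B + K|\<close>, since each fibre parallel to \<open>w\<close> gets shorter. The slice of \<open>B + P K\<close> at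
  height \<open>t\<close> is \<open>r P B + P K\<close> with \<open>r = sqrt (1 - t\<^sup>2)\<close>, and it contains a translate of
  \<open>r (P B + P K)\<close> because \<open>P K\<close> is convex.\<close>

section \<open>Lebesgue measure under translations and linear maps, and its fibres along a
  line\<close>

lemma nn_integral_lborel_translate:
  fixes f :: "'a::euclidean_space \<Rightarrow> ennreal"
  assumes [measurable]: "f \<in> borel_measurable borel"
  shows "(\<integral>\<^sup>+x. f (x + c) \<partial>lborel) = (\<integral>\<^sup>+x. f x \<partial>lborel)"
proof -
  have "(\<integral>\<^sup>+x. f x \<partial>lborel) = (\<integral>\<^sup>+x. f x \<partial>distr lborel borel ((+) c))"
    by (simp add: lborel_distr_plus)
  then show ?thesis
    by (simp add: nn_integral_distr add.commute)
qed

lemma emeasure_lborel_translate: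
  fixes A :: "'a::euclidean_space set"
  assumes "A \<in> sets borel"
  shows "emeasure lborel ((\<lambda>x. x + c) ` A) = emeasure lborel A"
proof -
  have "emeasure lborel A = emeasure (distr lborel borel ((+) (-c))) A"
    by (simp add: lborel_distr_plus)
  also have "\<dots> = emeasure lborel ((+) (-c) -` A)"
    using assms by (simp add: emeasure_distr)
  also have "(+) (-c) -` A = (\<lambda>x. x + c) ` A"
    by (force simp: image_iff)
  finally show ?thesis ..
qed

text \<open>The Haar uniqueness argument: substitute \<open>x \<mapsto> x + T y\<close> and \<open>y \<mapsto> y - S x\<close>, with
  \<open>S\<close> the inverse of \<open>T\<close>, in the double integral of \<open>indicator A (S x) * indicator C y\<close>.\<close>

lemma emeasure_linear_image:
  fixes T :: "'a::euclidean_space \<Rightarrow> 'a"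
  assumes T: "linear T" "inj T"
  obtains c where "\<And>A. A \<in> sets borel \<Longrightarrow> emeasure lborel (T ` A) = c * emeasure lborel A"
proof -
  obtain S where S: "linear S" "\<And>x. S (T x) = x" "\<And>x. T (S x) = x"
    using linear_injective_isomorphism[OF T] by blast
  \<comment> \<open>The reference set must have positive finite volume, so that it can be divided
    out, and be symmetric: the second substitution produces \<open>- (y - S x)\<close> in place of
    \<open>y - S x\<close>.\<close>
  define C :: "'a set" where "C = cball 0 1"
  have [measurable]: "T \<in> borel_measurable borel" "S \<in> borel_measurable borel"
    using T(1) S(1) by (auto intro!: borel_measurable_continuous_onI linear_continuous_on 
        simp: linear_conv_bounded_linear)
  have [measurable]: "C \<in> sets borel" by (simp add: C_def)
  have img: "T ` A = S -` A" for A
    using S(2,3) by (auto simp: image_iff) metis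
  have key: "emeasure lborel (T ` A) * emeasure lborel C = emeasure lborel A * emeasure lborel (T ` C)"
    if [measurable]: "A \<in> sets borel" for A
  proof -
    have "emeasure lborel (T ` A) * emeasure lborel C 
        = (\<integral>\<^sup>+y. \<integral>\<^sup>+x. indicator A (S x) * indicator C y \<partial>lborel \<partial>lborel)"
    proof -
      have "(\<integral>\<^sup>+x. indicator A (S x) \<partial>lborel) = emeasure lborel (T ` A)"
      proof -
        have "(\<integral>\<^sup>+x. indicator A (S x) \<partial>lborel) = (\<integral>\<^sup>+x. indicator (S -` A) x \<partial>lborel)"
          by (simp add: indicator_def)
        also have "\<dots> = emeasure lborel (S -` A)"
          using measurable_sets[OF \<open>S \<in> borel_measurable borel\<close> that]
          by (intro nn_integral_indicator) simp
        finally show ?thesis by (simp add: img)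
      qed
      then show ?thesis
        by (simp add: nn_integral_multc nn_integral_cmult)
    qed
    also have "\<dots> = (\<integral>\<^sup>+y. \<integral>\<^sup>+x. indicator A (S (x + T y)) * indicator C y \<partial>lborel \<partial>lborel)"
      by (intro nn_integral_cong nn_integral_lborel_translate[symmetric]) simp
    also have "\<dots> = (\<integral>\<^sup>+x. \<integral>\<^sup>+y. indicator A (S (x + T y)) * indicator C y \<partial>lborel \<partial>lborel)"
      by (rule lborel_pair.Fubini') simp
    also have "\<dots> = (\<integral>\<^sup>+x. \<integral>\<^sup>+y. indicator A (S x + y) * indicator C y \<partial>lborel \<partial>lborel)"
      using S by (simp add: linear_add)
    also have "\<dots> = (\<integral>\<^sup>+x. \<integral>\<^sup>+y. indicator A (S x + (y + - S x)) * indicator C (y + - S x) \<partial>lborel \<partial>lborel)"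
      by (intro nn_integral_cong nn_integral_lborel_translate[symmetric]) simp
    also have "\<dots> = (\<integral>\<^sup>+y. \<integral>\<^sup>+x. indicator A y * indicator C (y + - S x) \<partial>lborel \<partial>lborel)"
      by (subst lborel_pair.Fubini') auto
    also have "\<dots> = (\<integral>\<^sup>+y. \<integral>\<^sup>+x. indicator A y * indicator C (S (x + - T y)) \<partial>lborel \<partial>lborel)"
    proof (intro nn_integral_cong)
      fix y x :: 'a
      have "S (x + - T y) = - (y + - S x)"
        using S by (simp add: linear_diff)
      moreover have "indicator C (- z) = (indicator C z :: ennreal)" for z
        by (auto simp: C_def indicator_def)
      ultimately show "indicator A y * indicator C (y + - S x) =
          indicator A y * (indicator C (S (x + - T y)) :: ennreal)"
        by metis
    qed
    also have "\<dots> = (\<integral>\<^sup>+y. \<integral>\<^sup>+x. indicator A y * indicator C (S x) \<partial>lborel \<partial>lborel)"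
      by (intro nn_integral_cong nn_integral_lborel_translate) simp
    also have "\<dots> = emeasure lborel A * emeasure lborel (T ` C)"
    proof -
      have "(\<integral>\<^sup>+x. indicator C (S x) \<partial>lborel) = (\<integral>\<^sup>+x. indicator (S -` C) x \<partial>lborel)"
        by (simp add: indicator_def)
      also have "\<dots> = emeasure lborel (S -` C)"
        using measurable_sets[OF \<open>S \<in> borel_measurable borel\<close> \<open>C \<in> sets borel\<close>]
        by (intro nn_integral_indicator) simp
      finally have "(\<integral>\<^sup>+x. indicator C (S x) \<partial>lborel) = emeasure lborel (T ` C)"
        by (simp add: img)
      then show ?thesis
        by (simp add: nn_integral_multc nn_integral_cmult)
    qed
    finally show ?thesis .
  qed
  have C: "emeasure lborel C \<noteq> 0" "emeasure lborel C \<noteq> \<infinity>"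
    using emeasure_lborel_cball_finite[of 0 1] content_cball_pos[of 1 "0::'a"]
    by (auto simp: C_def measure_def)
  show ?thesis
  proof (rule that)
    fix A :: "'a set" assume "A \<in> sets borel"
    from key[OF this] have "emeasure lborel (T ` A) * emeasure lborel C / emeasure lborel C =
        emeasure lborel A * emeasure lborel (T ` C) / emeasure lborel C"
      by simp
    then show "emeasure lborel (T ` A) = emeasure lborel (T ` C) / emeasure lborel C * emeasure lborel A"
      using C by (metis ennreal_times_divide mult.commute mult_divide_eq_ennreal infinity_ennreal_def)
  qed
qed

text \<open>Fubini for lines parallel to \<open>w\<close>, with the outer integral kept in the
  ambient space. Instead of integrating over the hyperplane orthogonal to \<open>w\<close>, it
  integrates over the slab of height 1 above it; every line meets the slab in unit length, so each
  fibre is counted once.\<close>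

lemma emeasure_eq_integral_fibres:
  fixes w :: "'a::euclidean_space"
  assumes w: "norm w = 1" and [measurable]: "A \<in> sets borel"
  shows "emeasure lborel A =
    (\<integral>\<^sup>+y. \<integral>\<^sup>+t. indicator {y. 0 \<le> y \<bullet> w \<and> y \<bullet> w \<le> 1} y * indicator A (y - (y \<bullet> w) *\<^sub>R w + t *\<^sub>R w) \<partial>lborel \<partial>lborel)"
proof -
  define C where "C = {y. 0 \<le> y \<bullet> w \<and> y \<bullet> w \<le> 1}"
  have [measurable]: "C \<in> sets borel"
    unfolding C_def by measurable
  have ww: "w \<bullet> w = 1" using w by (simp add: norm_eq_1)
  have "(\<integral>\<^sup>+y. \<integral>\<^sup>+t. indicator C y * indicator A (y - (y \<bullet> w) *\<^sub>R w + t *\<^sub>R w) \<partial>lborel \<partial>lborel) = 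
    (\<integral>\<^sup>+y. \<integral>\<^sup>+t. indicator C y * indicator A (y - (y \<bullet> w) *\<^sub>R w + (t + y \<bullet> w) *\<^sub>R w) \<partial>lborel \<partial>lborel)"
    by (intro nn_integral_cong nn_integral_lborel_translate[symmetric]) simp
  also have "\<dots> = (\<integral>\<^sup>+y. \<integral>\<^sup>+t. indicator C y * indicator A (y + t *\<^sub>R w) \<partial>lborel \<partial>lborel)"
    by (simp add: algebra_simps)
  also have "\<dots> = (\<integral>\<^sup>+t. \<integral>\<^sup>+y. indicator C y * indicator A (y + t *\<^sub>R w) \<partial>lborel \<partial>lborel)"
    by (rule lborel_pair.Fubini') simp
  also have "\<dots> = (\<integral>\<^sup>+t. \<integral>\<^sup>+y. indicator C (y + - (t *\<^sub>R w)) * indicator A (y + - (t *\<^sub>R w) + t *\<^sub>R w) \<partial>lborel \<partial>lborel)"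
    by (intro nn_integral_cong nn_integral_lborel_translate[symmetric]) simp
  also have "\<dots> = (\<integral>\<^sup>+y. \<integral>\<^sup>+t. indicator C (y + - (t *\<^sub>R w)) * indicator A y \<partial>lborel \<partial>lborel)"
    by (subst lborel_pair.Fubini') (auto simp: algebra_simps)
  \<comment> \<open>For fixed \<open>y\<close> the slab condition on
    \<open>y - t *\<^sub>R w\<close> confines \<open>t\<close> to an interval of length 1.\<close>
  also have "\<dots> = (\<integral>\<^sup>+y. \<integral>\<^sup>+t. indicator {y \<bullet> w - 1..y \<bullet> w} t * indicator A y \<partial>lborel \<partial>lborel)"
    by (intro nn_integral_cong) (auto simp: C_def indicator_def algebra_simps ww)
  also have "\<dots> = (\<integral>\<^sup>+y. indicator A y \<partial>lborel)"
    by (intro nn_integral_cong) (simp add: nn_integral_multc)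
  finally show ?thesis
    by (simp add: C_def)
qed

section \<open>Orthogonal projections and the cylinders over them\<close>

definition orthonormal :: "'a::euclidean_space set \<Rightarrow> bool" where
  "orthonormal W \<longleftrightarrow> finite W \<and> pairwise orthogonal W \<and> (\<forall>v\<in>W. norm v = 1)"

text \<open>For orthonormal \<open>W\<close> this is the projection along \<open>W\<close>, that is,
  onto the orthogonal complement of its span.\<close>

definition proj :: "'a::euclidean_space set \<Rightarrow> 'a \<Rightarrow> 'a" where
  "proj W x = x - (\<Sum>v\<in>W. (x \<bullet> v) *\<^sub>R v)"

text \<open>Volumes of projections along \<open>W\<close> are computed in the ambient space: the projection is multiplied
  by the unit cube spanned by \<open>W\<close>.\<close>

definition ball_cyl :: "'a::euclidean_space set \<Rightarrow> real \<Rightarrow> 'a set" where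
  "ball_cyl W r = {x. (\<forall>v\<in>W. 0 \<le> x \<bullet> v \<and> x \<bullet> v \<le> 1) \<and> norm (proj W x) \<le> r}"

text \<open>For a unit vector \<open>w\<close>, quantifying over \<open>t\<close> forgets the height
  of the points of \<open>X\<close>, and the slab gives height 1. The volume is thus that of the
  projection of \<open>X\<close> along \<open>w\<close>, one dimension lower.\<close>

definition cylinder :: "'a::euclidean_space \<Rightarrow> 'a set \<Rightarrow> 'a set" where
  "cylinder w X = {y. 0 \<le> y \<bullet> w \<and> y \<bullet> w \<le> 1 \<and> (\<exists>t. y - (y \<bullet> w) *\<^sub>R w + t *\<^sub>R w \<in> X)}"

lemma orthonormal_empty [simp]: "orthonormal {}"
  by (simp add: orthonormal_def)

lemma orthonormal_insertD:
  assumes "orthonormal (insert w W)"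
  shows "orthonormal W" "w \<bullet> w = 1" "norm w = 1"
  using assms by (auto simp: orthonormal_def pairwise_insert norm_eq_1)

lemma orthonormal_insert_inner:
  assumes "orthonormal (insert w W)" "w \<notin> W" "v \<in> W"
  shows "w \<bullet> v = 0" "v \<bullet> w = 0"
  using assms by (auto simp: orthonormal_def pairwise_insert orthogonal_def)

lemma linear_proj: "linear (proj W)"
  by (rule linearI) (simp_all add: proj_def inner_add_left scaleR_add_left sum.distrib 
     scaleR_sum_right scaleR_diff_right)

lemmas proj_simps = linear_add[OF linear_proj] linear_diff[OF linear_proj] linear_cmul[OF linear_proj]

lemma proj_empty [simp]: "proj {} = (\<lambda>x. x)"
  by (simp add: proj_def fun_eq_iff)

lemma proj_0 [simp]: "proj W 0 = 0"
  by (simp add: proj_def)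

lemma inner_sum_orthonormal:
  assumes "orthonormal W" "v \<in> W"
  shows "(\<Sum>u\<in>W. c u *\<^sub>R u) \<bullet> v = c v"
proof -
  have "(\<Sum>u\<in>W. c u *\<^sub>R u) \<bullet> v = (\<Sum>u\<in>W. if u = v then c u else 0)"
    unfolding inner_sum_left using assms
    by (intro sum.cong) (auto simp: orthonormal_def pairwise_def orthogonal_def norm_eq_1)
  then show ?thesis
    using assms by (simp add: orthonormal_def)
qed

lemma inner_proj_eq_0:
  assumes "orthonormal W" "v \<in> W"
  shows "proj W x \<bullet> v = 0"
  using inner_sum_orthonormal[OF assms] by (simp add: proj_def inner_diff_left)

lemma proj_eq_self:
  assumes "\<And>v. v \<in> W \<Longrightarrow> x \<bullet> v = 0"
  shows "proj W x = x"
  using assms by (simp add: proj_def)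

lemma proj_proj:
  assumes "orthonormal W"
  shows "proj W (proj W x) = proj W x"
  by (intro proj_eq_self inner_proj_eq_0 assms)

lemma proj_eq_0:
  assumes "orthonormal W" "v \<in> W"
  shows "proj W v = 0"
proof -
  have "(\<Sum>u\<in>W. (v \<bullet> u) *\<^sub>R u) = (\<Sum>u\<in>W. if u = v then v else 0)"
    using assms
    by (intro sum.cong) (auto simp: orthonormal_def pairwise_def orthogonal_def norm_eq_1)
  then show ?thesis
    using assms by (simp add: proj_def orthonormal_def)
qed

lemma proj_insert:
  assumes "orthonormal (insert w W)" "w \<notin> W"
  shows "proj (insert w W) x = proj W x - (x \<bullet> w) *\<^sub>R w"
  using assms by (simp add: proj_def orthonormal_def)

lemma proj_insert_self:
  assumes "orthonormal (insert w W)" "w \<notin> W"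
  shows "proj W w = w"
  using orthonormal_insert_inner[OF assms] by (simp add: proj_eq_self)

lemma inner_proj_insert:
  assumes "orthonormal (insert w W)" "w \<notin> W"
  shows "proj W x \<bullet> w = x \<bullet> w"
  using orthonormal_insert_inner[OF assms] by (simp add: proj_def inner_diff_left inner_sum_left)

text \<open>Pythagoras. Later it turns the slice of a ball cylinder at height \<open>t\<close> into
  a ball cylinder of smaller radius.\<close>

lemma norm_proj_insert:
  assumes "orthonormal (insert w W)" "w \<notin> W"
  shows "(norm (proj W x))\<^sup>2 = (norm (proj (insert w W) x))\<^sup>2 + (x \<bullet> w)\<^sup>2"
proof -
  have "proj W x = proj (insert w W) x + (x \<bullet> w) *\<^sub>R w"
    using proj_insert[OF assms] by simp
  moreover have "orthogonal (proj (insert w W) x) ((x \<bullet> w) *\<^sub>R w)"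
    using inner_proj_eq_0[OF assms(1)] by (simp add: orthogonal_def)
  ultimately have "(norm (proj W x))\<^sup>2 = (norm (proj (insert w W) x))\<^sup>2 + (norm ((x \<bullet> w) *\<^sub>R w))\<^sup>2"
    by (metis norm_add_Pythagorean)
  then show ?thesis
    using orthonormal_insertD(3)[OF assms(1)] by simp
qed

lemma norm_proj_le:
  assumes "orthonormal W"
  shows "norm (proj W x) \<le> norm x"
proof -
  have "finite W" using assms by (simp add: orthonormal_def)
  then show ?thesis using assms
  proof (induction W rule: finite_induct)
    case (insert w W)
    have "(norm (proj (insert w W) x))\<^sup>2 \<le> (norm (proj W x))\<^sup>2"
      using norm_proj_insert[OF insert.prems insert.hyps(2), of x] by simp
    then have "norm (proj (insert w W) x) \<le> norm (proj W x)"
      by (rule power2_le_imp_le) simp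
    then show ?case
      using insert.IH orthonormal_insertD(1)[OF insert.prems] by linarith
  qed simp
qed

lemma continuous_on_proj [continuous_intros]: "continuous_on S (proj W)"
  by (simp add: linear_continuous_on linear_conv_bounded_linear[symmetric] linear_proj)

lemma compact_ball_cyl:
  assumes "orthonormal W"
  shows "compact (ball_cyl W r)"
proof (rule compact_eq_bounded_closed[THEN iffD2], intro conjI)
  have "ball_cyl W r = (\<Inter>v\<in>W. {x. 0 \<le> x \<bullet> v} \<inter> {x. x \<bullet> v \<le> 1}) \<inter> {x. norm (proj W x) \<le> r}"
    by (auto simp: ball_cyl_def)
  moreover have "closed \<dots>"
    by (intro closed_Int closed_INT ballI closed_Collect_le continuous_intros continuous_on_proj)
  ultimately show "closed (ball_cyl W r)" by simp
  show "bounded (ball_cyl W r)"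
  proof (rule boundedI)
    fix x assume x: "x \<in> ball_cyl W r"
    have "x = proj W x + (\<Sum>v\<in>W. (x \<bullet> v) *\<^sub>R v)" by (simp add: proj_def)
    then have "norm x \<le> norm (proj W x) + norm (\<Sum>v\<in>W. (x \<bullet> v) *\<^sub>R v)"
      by (metis norm_triangle_ineq)
    also have "\<dots> \<le> r + (\<Sum>v\<in>W. 1)"
      using x assms by (intro add_mono order_trans[OF norm_sum] sum_mono) 
        (auto simp: ball_cyl_def orthonormal_def)
    finally show "norm x \<le> r + (\<Sum>v\<in>W. 1)" .
  qed
qed

lemma convex_ball_cyl: "convex (ball_cyl W r)"
proof -
  have "ball_cyl W r = (\<Inter>v\<in>W. {x. v \<bullet> x \<ge> 0} \<inter> {x. v \<bullet> x \<le> 1}) \<inter> (proj W -` cball 0 r)"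
    by (auto simp: ball_cyl_def inner_commute)
  moreover have "convex \<dots>"
    by (intro convex_Int convex_INT convex_halfspace_ge convex_halfspace_le 
       convex_linear_vimage linear_proj convex_cball)
  ultimately show ?thesis by simp
qed

lemma ball_cyl_empty [simp]: "ball_cyl {} r = cball 0 r"
  by (auto simp: ball_cyl_def)

text \<open>The centre \<open>c\<close> of the unit cube spanned by \<open>W\<close> has all
  coordinates 1/2, so a ball of radius 1/2 around it fits. Positivity allows this volume to be
  cancelled in the induction over directions.\<close>

lemma emeasure_ball_cyl_pos:
  assumes W: "orthonormal W"
  shows "emeasure lborel (ball_cyl W 1) > 0"
proof -
  define c where "c = (\<Sum>v\<in>W. (1/2) *\<^sub>R v)"
  have "cball c (1/2) \<subseteq> ball_cyl W 1"
  proof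
    fix x assume "x \<in> cball c (1/2)"
    then have n: "norm (x - c) \<le> 1/2" by (simp add: dist_norm norm_minus_commute)
    have "0 \<le> x \<bullet> v \<and> x \<bullet> v \<le> 1" if v: "v \<in> W" for v
    proof -
      have "\<bar>(x - c) \<bullet> v\<bar> \<le> 1/2"
        using Cauchy_Schwarz_ineq2[of "x - c" v] n W v by (auto simp: orthonormal_def)
      moreover have "c \<bullet> v = 1/2"
        unfolding c_def by (rule inner_sum_orthonormal[OF W v])
      ultimately show ?thesis unfolding inner_diff_left by linarith
    qed
    moreover have "proj W c = 0"
      unfolding c_def using W by (simp add: linear_sum[OF linear_proj] proj_simps proj_eq_0)
    then have "norm (proj W x) \<le> 1"
      using norm_proj_le[OF W, of "x - c"] n by (simp add: proj_simps)
    ultimately show "x \<in> ball_cyl W 1" by (auto simp: ball_cyl_def)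
  qed
  then have "emeasure lborel (cball c (1/2)) \<le> emeasure lborel (ball_cyl W 1)"
    using compact_ball_cyl[OF W] by (intro emeasure_mono) (auto simp: borel_compact)
  moreover have "emeasure lborel (cball c (1/2)) > 0"
    using content_cball_pos[of "1/2" c] by (auto simp: measure_def zero_less_iff_neq_zero)
  ultimately show ?thesis by order
qed

lemma compact_set_plus:
  fixes A B :: "'a::real_normed_vector set"
  assumes "compact A" "compact B"
  shows "compact (A + B)"
proof -
  have "A + B = (\<Union>x\<in>A. \<Union>y\<in>B. {x + y})" by (auto simp: set_plus_def)
  then show ?thesis using compact_sums'[OF assms] by simp
qed

text \<open>The cylinder is a continuous image of \<open>X \<times> {0..1}\<close>: the height of a
  point of \<open>X\<close> is overwritten by the second coordinate. Compactness then gives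
  measurability despite the existential quantifier.\<close>

lemma compact_cylinder:
  fixes X :: "'a::euclidean_space set"
  assumes "compact X" "norm w = 1"
  shows "compact (cylinder w X)"
proof -
  have ww: "w \<bullet> w = 1" using assms by (simp add: norm_eq_1)
  have "cylinder w X = (\<lambda>(x, s). x - (x \<bullet> w) *\<^sub>R w + s *\<^sub>R w) ` (X \<times> {0..1})"
  proof (intro equalityI subsetI)
    fix y assume "y \<in> cylinder w X"
    then obtain t where t: "0 \<le> y \<bullet> w" "y \<bullet> w \<le> 1" "y - (y \<bullet> w) *\<^sub>R w + t *\<^sub>R w \<in> X"
      by (auto simp: cylinder_def)
    have "(y - (y \<bullet> w) *\<^sub>R w + t *\<^sub>R w) \<bullet> w = t"
      by (simp add: inner_add_left inner_diff_left ww)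
    with t show "y \<in> (\<lambda>(x, s). x - (x \<bullet> w) *\<^sub>R w + s *\<^sub>R w) ` (X \<times> {0..1})"
      by (intro image_eqI[of _ _ "(y - (y \<bullet> w) *\<^sub>R w + t *\<^sub>R w, y \<bullet> w)"]) auto
  next
    fix y assume "y \<in> (\<lambda>(x, s). x - (x \<bullet> w) *\<^sub>R w + s *\<^sub>R w) ` (X \<times> {0..1})"
    then obtain x s where x: "x \<in> X" "0 \<le> s" "s \<le> 1" "y = x - (x \<bullet> w) *\<^sub>R w + s *\<^sub>R w"
      by auto
    then have yw: "y \<bullet> w = s" 
      by (simp add: inner_add_left inner_diff_left ww)
    have "y - s *\<^sub>R w + (x \<bullet> w) *\<^sub>R w = x" using x(4) by simp
    then have "y - s *\<^sub>R w + (x \<bullet> w) *\<^sub>R w \<in> X" using x(1) by simp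
    then show "y \<in> cylinder w X"
      using x(2,3) unfolding cylinder_def mem_Collect_eq yw by blast
  qed
  moreover have "compact \<dots>"
    using assms unfolding case_prod_beta
    by (intro compact_continuous_image continuous_intros compact_Times compact_Icc)
  ultimately show ?thesis by simp
qed

text \<open>Projecting along \<open>w\<close> commutes with sums and maps the ball part to the unit
  ball one dimension lower. Hence the cylinder that appears when a segment is added is again a ball
  cylinder plus a projection, now for \<open>insert w W\<close>.\<close>

lemma cylinder_ball_cyl_plus:
  assumes W: "orthonormal (insert w W)" "w \<notin> W"
  shows "cylinder w (ball_cyl W 1 + proj W ` A) = ball_cyl (insert w W) 1 + proj (insert w W) ` A"
proof (intro equalityI subsetI)
  note [simp] = orthonormal_insert_inner(1)[OF W] orthonormal_insertD(2)[OF W(1)]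
     inner_proj_insert[OF W] proj_insert_self[OF W]
  have pw: "proj (insert w W) w = 0" "\<And>x. proj (insert w W) x \<bullet> w = 0"
      "\<And>x v. v \<in> W \<Longrightarrow> proj (insert w W) x \<bullet> v = 0"
    using proj_eq_0[OF W(1)] inner_proj_eq_0[OF W(1)] by blast+
  {
    fix y assume "y \<in> cylinder w (ball_cyl W 1 + proj W ` A)"
    then obtain t d a where y: "0 \<le> y \<bullet> w" "y \<bullet> w \<le> 1" and d: "d \<in> ball_cyl W 1" and "a \<in> A" 
      and eq: "y - (y \<bullet> w) *\<^sub>R w + t *\<^sub>R w = d + proj W a"
      unfolding cylinder_def set_plus_def by blast
    \<comment> \<open>\<open>d'\<close> differs from \<open>d\<close> by a multiple of
      \<open>w\<close> and has the height of \<open>y\<close>; its projection along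
      \<open>insert w W\<close> is that of \<open>d\<close>, which is no longer than
      \<open>proj W d\<close>.\<close>
    define d' where "d' = y - proj (insert w W) a"
    have "d' = (d + proj W a) + (y \<bullet> w - t) *\<^sub>R w - proj (insert w W) a"
      unfolding d'_def eq[symmetric] by (simp add: algebra_simps)
    then have d': "d' = d + (a \<bullet> w + y \<bullet> w - t) *\<^sub>R w"
      by (simp add: proj_insert[OF W] algebra_simps)
    have "proj (insert w W) d' = proj (insert w W) d"
      unfolding d' by (simp add: proj_simps pw)
    moreover have "norm (proj (insert w W) d) \<le> norm (proj W d)"
      using norm_proj_insert[OF W, of d] by (intro power2_le_imp_le[OF _ norm_ge_zero]) simp
    moreover have "d' \<bullet> w = y \<bullet> w" by (simp add: d'_def inner_diff_left pw)
    moreover have "d' \<bullet> v = d \<bullet> v" if "v \<in> W" for v using that by (simp add: d' inner_add_left)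
    ultimately have "d' \<in> ball_cyl (insert w W) 1"
      using y d by (auto simp: ball_cyl_def)
    then have "d' + proj (insert w W) a \<in> ball_cyl (insert w W) 1 + proj (insert w W) ` A"
      using \<open>a \<in> A\<close> by (intro set_plus_intro imageI)
    then show "y \<in> ball_cyl (insert w W) 1 + proj (insert w W) ` A"
      by (simp add: d'_def)
  next
    fix y assume "y \<in> ball_cyl (insert w W) 1 + proj (insert w W) ` A"
    then obtain d a where d: "d \<in> ball_cyl (insert w W) 1" and "a \<in> A" 
      and y: "y = d + proj (insert w W) a"
      unfolding set_plus_def by blast
    have yw: "y \<bullet> w = d \<bullet> w" by (simp add: y inner_add_left pw)
    have "proj W (d - (d \<bullet> w) *\<^sub>R w) = proj (insert w W) d"
      by (simp add: proj_simps proj_insert[OF W])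
    then have "d - (d \<bullet> w) *\<^sub>R w \<in> ball_cyl W 1"
      using d by (auto simp: ball_cyl_def inner_diff_left)
    \<comment> \<open>The line through \<open>y\<close> is met at height
      \<open>a \<bullet> w\<close>, since the ball part has been moved to height 0.\<close>
    moreover have "y - (y \<bullet> w) *\<^sub>R w + (a \<bullet> w) *\<^sub>R w = (d - (d \<bullet> w) *\<^sub>R w) + proj W a"
      unfolding yw by (simp add: y proj_insert[OF W])
    ultimately have "y - (y \<bullet> w) *\<^sub>R w + (a \<bullet> w) *\<^sub>R w \<in> ball_cyl W 1 + proj W ` A"
      using \<open>a \<in> A\<close> by (simp add: set_plus_intro)
    moreover have "0 \<le> y \<bullet> w" "y \<bullet> w \<le> 1"
      using yw d by (auto simp: ball_cyl_def)
    ultimately show "y \<in> cylinder w (ball_cyl W 1 + proj W ` A)"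
      unfolding cylinder_def by blast
  }
qed

section \<open>Volume growth when a segment is added\<close>

text \<open>Every nonempty fibre of \<open>X\<close> parallel to \<open>w\<close> is a compact
  interval, and adding the segment lengthens it by exactly \<open>s\<close>. The lines with nonempty
  fibre are measured by the cylinder.\<close>

lemma emeasure_plus_segment:
  fixes X :: "'a::euclidean_space set"
  assumes X: "compact X" "convex X" and w: "norm w = 1" and s: "s \<ge> 0"
  shows "emeasure lborel (X + closed_segment 0 (s *\<^sub>R w)) 
       = emeasure lborel X + ennreal s * emeasure lborel (cylinder w X)"
proof -
  have ww: "w \<bullet> w = 1" using w by (simp add: norm_eq_1)
  define C where "C = {y. 0 \<le> y \<bullet> w \<and> y \<bullet> w \<le> 1}"
  define p where "p y = y - (y \<bullet> w) *\<^sub>R w" for y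
  define F where "F Y y = {t. p y + t *\<^sub>R w \<in> Y}" for Y y
  have seg: "closed_segment 0 (s *\<^sub>R w) = (\<lambda>t. t *\<^sub>R w) ` {0..s}"
  proof -
    have "closed_segment 0 (s *\<^sub>R w) = (\<lambda>t. t *\<^sub>R w) ` closed_segment 0 s"
      by (subst closed_segment_linear_image[symmetric]) (auto intro: linearI simp: scaleR_add_left)
    then show ?thesis using s by (simp add: closed_segment_eq_real_ivl)
  qed
  have [measurable]: "C \<in> sets borel" unfolding C_def by measurable
  have [measurable]: "p \<in> borel_measurable borel" unfolding p_def by measurable
  have fibre_integral: "(\<integral>\<^sup>+t. indicator Y (p y + t *\<^sub>R w) \<partial>lborel) = emeasure lborel (F Y y)"
    if [measurable]: "Y \<in> sets borel" for Y y
  proof -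
    have "F Y y \<in> sets borel" unfolding F_def by measurable
    then have "emeasure lborel (F Y y) = (\<integral>\<^sup>+t. indicator (F Y y) t \<partial>lborel)" by simp
    then show ?thesis by (simp add: F_def indicator_def)
  qed
  have fibre: "emeasure lborel Y = (\<integral>\<^sup>+y. indicator C y * emeasure lborel (F Y y) \<partial>lborel)"
    if Y: "compact Y" for Y
  proof -
    have [measurable]: "Y \<in> sets borel" using Y by (rule borel_compact)
    show ?thesis
      using fibre_integral[OF \<open>Y \<in> sets borel\<close>]
      unfolding emeasure_eq_integral_fibres[OF w \<open>Y \<in> sets borel\<close>]
      by (simp add: nn_integral_cmult flip: C_def p_def)
  qed
  \<comment> \<open>Convexity enters here: a fibre with gaps could grow by more than
    \<open>s\<close>. An empty fibre is covered by \<open>a > b\<close>.\<close>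
  have F_X: "\<exists>a b. F X y = {a..b}" for y
  proof -
    have "convex (F X y)"
    proof (rule convexI)
      fix a b u v :: real assume "a \<in> F X y" "b \<in> F X y" and uv: "0 \<le> u" "0 \<le> v" "u + v = 1"
      then have "u *\<^sub>R (p y + a *\<^sub>R w) + v *\<^sub>R (p y + b *\<^sub>R w) \<in> X"
        using X(2) by (auto simp: F_def convex_def)
      moreover have "u *\<^sub>R (p y + a *\<^sub>R w) + v *\<^sub>R (p y + b *\<^sub>R w) 
          = (u + v) *\<^sub>R p y + (u *\<^sub>R a + v *\<^sub>R b) *\<^sub>R w" by (simp add: algebra_simps)
      ultimately show "u *\<^sub>R a + v *\<^sub>R b \<in> F X y" using uv by (simp add: F_def)
    qed
    moreover have "compact (F X y)"
    proof -
      have "closed ((\<lambda>t. p y + t *\<^sub>R w) -` X)"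
        by (intro closed_vimage compact_imp_closed X continuous_intros)
      then have "closed (F X y)" by (simp add: F_def vimage_def)
      moreover have "bounded (F X y)"
      proof -
        obtain B where B: "\<And>x. x \<in> X \<Longrightarrow> norm x \<le> B"
          using compact_imp_bounded[OF X(1)] by (auto simp: bounded_iff)
        show ?thesis
        proof (rule boundedI)
          fix t assume "t \<in> F X y"
          then have "norm (p y + t *\<^sub>R w) \<le> B" using B by (simp add: F_def)
          then have "norm ((p y + t *\<^sub>R w) - p y) \<le> B + norm (p y)"
            using norm_triangle_ineq4[of "p y + t *\<^sub>R w" "p y"] by linarith
          then show "norm t \<le> B + norm (p y)" using w by simp
        qed
      qed
      ultimately show ?thesis by (simp add: compact_eq_bounded_closed)
    qed
    ultimately show ?thesis
      using connected_compact_interval_1[of "F X y"] convex_connected[of "F X y"] by auto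
  qed
  have F_plus: "F (X + closed_segment 0 (s *\<^sub>R w)) y = {t. \<exists>r\<in>{0..s}. t - r \<in> F X y}" for y
  proof -
    have *: "p y + t *\<^sub>R w = x + r *\<^sub>R w \<longleftrightarrow> p y + (t - r) *\<^sub>R w = x" for t r x
      by (auto simp: algebra_simps)
    have "F (X + closed_segment 0 (s *\<^sub>R w)) y = {t. \<exists>x\<in>X. \<exists>r\<in>{0..s}. p y + t *\<^sub>R w = x + r *\<^sub>R w}"
      unfolding seg F_def set_plus_def by blast
    then show ?thesis unfolding * F_def by blast
  qed
  have fibre_plus: "indicator C y * emeasure lborel (F (X + closed_segment 0 (s *\<^sub>R w)) y) = 
     indicator C y * emeasure lborel (F X y) + ennreal s * indicator (cylinder w X) y" for y
  proof -
    have cyl: "y \<in> cylinder w X \<longleftrightarrow> y \<in> C \<and> F X y \<noteq> {}"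
      by (auto simp: cylinder_def C_def F_def p_def)
    obtain a b where ab: "F X y = {a..b}" using F_X by blast
    show ?thesis
    proof (cases "a \<le> b")
      case True
      have "F (X + closed_segment 0 (s *\<^sub>R w)) y = {a..b + s}"
        unfolding F_plus ab
      proof (intro equalityI subsetI)
        fix t assume "t \<in> {a..b + s}"
        \<comment> \<open>The smallest shift that brings \<open>t\<close> back to at most
          \<open>b\<close>.\<close>
        then have "max 0 (t - b) \<in> {0..s}" "t - max 0 (t - b) \<in> {a..b}" using True s by auto
        then show "t \<in> {t. \<exists>r\<in>{0..s}. t - r \<in> {a..b}}" by blast
      qed auto
      then have "emeasure lborel (F (X + closed_segment 0 (s *\<^sub>R w)) y) = ennreal (b - a) + ennreal s"
        using True s by (simp flip: ennreal_plus add: algebra_simps)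
      then show ?thesis
        using True ab cyl by (auto simp: indicator_def)
    next
      case False
      then have "F (X + closed_segment 0 (s *\<^sub>R w)) y = {}" unfolding F_plus ab by auto
      then show ?thesis using False ab cyl by (auto simp: indicator_def)
    qed
  qed
  have [measurable]: "cylinder w X \<in> sets borel"
    using compact_cylinder[OF X(1) w] by (rule borel_compact)
  have XB: "X \<in> sets borel" using X(1) by (rule borel_compact)
  have [measurable]: "(\<lambda>y. indicator C y * emeasure lborel (F X y)) \<in> borel_measurable lborel"
  proof -
    have "(\<lambda>y. \<integral>\<^sup>+t. indicator X (p y + t *\<^sub>R w) \<partial>lborel) \<in> borel_measurable lborel"
      using XB by measurable
    then show ?thesis by (simp add: fibre_integral XB)
  qed
  have "emeasure lborel (X + closed_segment 0 (s *\<^sub>R w)) = 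
     (\<integral>\<^sup>+y. indicator C y * emeasure lborel (F X y) + ennreal s * indicator (cylinder w X) y \<partial>lborel)"
    using fibre[of "X + closed_segment 0 (s *\<^sub>R w)"] compact_set_plus[OF X(1) compact_segment] 
    by (simp add: fibre_plus)
  also have "\<dots> = emeasure lborel X + ennreal s * emeasure lborel (cylinder w X)"
    using fibre[OF X(1)] by (simp add: nn_integral_add nn_integral_cmult)
  finally show ?thesis .
qed

text \<open>For orthonormal \<open>W\<close> this is the volume, in the complement of the span of
  \<open>W\<close>, of the projection of the unit ball plus \<open>A\<close>. For
  \<open>W = {}\<close> it is the volume of the unit ball plus \<open>A\<close>.\<close>

definition cyl_volume :: "'a::euclidean_space set \<Rightarrow> 'a set \<Rightarrow> ennreal" where
  "cyl_volume W A = emeasure lborel (ball_cyl W 1 + proj W ` A)"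

lemma linear_image_set_plus:
  assumes "linear f"
  shows "f ` (A + B) = f ` A + f ` B"
proof (intro equalityI subsetI)
  fix y assume "y \<in> f ` (A + B)"
  then obtain a b where "a \<in> A" "b \<in> B" "y = f (a + b)" by (auto simp: set_plus_def)
  then show "y \<in> f ` A + f ` B" using linear_add[OF assms] by auto
next
  fix y assume "y \<in> f ` A + f ` B"
  then obtain a b where "a \<in> A" "b \<in> B" "y = f (a + b)"
    using linear_add[OF assms] by (auto simp: set_plus_def)
  then show "y \<in> f ` (A + B)" by auto
qed

lemma set_plus_translate:
  fixes A B :: "'a::ab_group_add set"
  shows "A + (\<lambda>x. x + c) ` B = (\<lambda>x. x + c) ` (A + B)"
proof -
  have "A + B = (\<Union>a\<in>A. \<Union>b\<in>B. {a + b})"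
    by (auto simp: set_plus_def)
  then have "(\<lambda>x. x + c) ` (A + B) = (\<Union>a\<in>A. \<Union>b\<in>B. {a + (b + c)})"
    by (simp only: image_UN image_insert image_empty add.assoc)
  also have "\<dots> = A + (\<lambda>x. x + c) ` B" by (auto simp: set_plus_def)
  finally show ?thesis ..
qed

text \<open>The point is that \<open>s\<close> and \<open>W'\<close> are fixed before
  \<open>A\<close>, so that expansions for different \<open>A\<close> can be compared term by term.
  The projected segment is orthogonal to \<open>W\<close>; its direction extends \<open>W\<close>
  and its length is \<open>s\<close>.\<close>

lemma cyl_volume_plus_segment:
  assumes W: "orthonormal W"
  obtains s W' where "orthonormal W'"
    "\<And>A. compact A \<Longrightarrow> convex A \<Longrightarrow>
        cyl_volume W (A + closed_segment a b) = cyl_volume W A + s * cyl_volume W' A"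
proof -
  define u where "u = proj W (b - a)"
  have *: "cyl_volume W (A + closed_segment a b) = 
      emeasure lborel (ball_cyl W 1 + proj W ` A + closed_segment 0 u)"
    if A: "compact A" for A
  proof -
    have "proj W ` (A + closed_segment a b) = proj W ` A + proj W ` closed_segment a b"
      by (rule linear_image_set_plus[OF linear_proj])
    also have "proj W ` closed_segment a b = closed_segment (proj W a + 0) (proj W a + u)"
      by (simp add: closed_segment_linear_image linear_proj u_def proj_simps)
    also have "\<dots> = (\<lambda>x. x + proj W a) ` closed_segment 0 u"
      unfolding closed_segment_translation by (simp add: add.commute)
    finally have "ball_cyl W 1 + proj W ` (A + closed_segment a b) = 
      (\<lambda>x. x + proj W a) ` (ball_cyl W 1 + proj W ` A + closed_segment 0 u)"
      by (simp add: set_plus_translate add.assoc)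
    moreover have "compact (ball_cyl W 1 + proj W ` A + closed_segment 0 u)"
      by (intro compact_set_plus compact_ball_cyl W compact_segment compact_continuous_image 
          continuous_on_proj A)
    ultimately show ?thesis
      by (simp add: cyl_volume_def emeasure_lborel_translate borel_compact)
  qed
  show ?thesis
  proof (cases "u = 0")
    case True
    then show ?thesis
      \<comment> \<open>The segment projects to a point, which only translates; the coefficient is 0
        and \<open>W\<close> is a placeholder.\<close>
      using * W by (intro that[of W 0]) (auto simp: cyl_volume_def)
  next
    case False
    define w where "w = u /\<^sub>R norm u"
    have w: "norm w = 1" "u = norm u *\<^sub>R w" using False by (auto simp: w_def)
    have perp: "w \<bullet> v = 0" if "v \<in> W" for v
      using inner_proj_eq_0[OF W that] by (simp add: w_def u_def)
    have "w \<notin> W" using perp[of w] w(1) by (auto simp: norm_eq_1)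
    moreover have W': "orthonormal (insert w W)"
      using W w perp by (auto simp: orthonormal_def pairwise_insert orthogonal_def inner_commute)
    ultimately have "cyl_volume W (A + closed_segment a b) = 
        cyl_volume W A + ennreal (norm u) * cyl_volume (insert w W) A"
      if A: "compact A" "convex A" for A
    proof -
      have "compact (ball_cyl W 1 + proj W ` A)" "convex (ball_cyl W 1 + proj W ` A)"
        by (intro compact_set_plus compact_ball_cyl W compact_continuous_image 
          continuous_on_proj A convex_set_plus convex_ball_cyl convex_linear_image linear_proj)+
      from emeasure_plus_segment[OF this w(1), of "norm u"] show ?thesis
        using cylinder_ball_cyl_plus[OF W' \<open>w \<notin> W\<close>, of A] *[OF A(1)] w(2)
        by (simp add: cyl_volume_def)
    qed
    then show ?thesis using W' by (intro that) auto
  qed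
qed

section \<open>The ratio inequality for projections\<close>

lemma emeasure_ball_cyl_shrink:
  assumes V: "orthonormal V" and K: "compact K" "convex K" "K \<noteq> {}" and r: "0 < r" "r \<le> 1"
  shows "emeasure lborel (ball_cyl V r) * cyl_volume V K
       \<le> emeasure lborel (ball_cyl V r + proj V ` K) * emeasure lborel (ball_cyl V 1)"
proof -
  define M where "M x = x - (1 - r) *\<^sub>R proj V x" for x
  have M: "linear M"
    unfolding M_def by (intro linear_compose_sub linear_compose_scale_right linear_proj linear_ident)
  have pM: "proj V (M x) = r *\<^sub>R proj V x" for x
    by (simp add: M_def proj_simps proj_proj[OF V] algebra_simps)
  have Minner: "M x \<bullet> v = x \<bullet> v" if "v \<in> V" for x v
    using inner_proj_eq_0[OF V that] by (simp add: M_def inner_diff_left)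
  have "inj M"
    unfolding linear_injective_0[OF M]
  proof (intro allI impI)
    fix x assume 0: "M x = 0"
    then have "proj V x = 0" using pM[of x] r by simp
    with 0 show "x = 0" by (simp add: M_def)
  qed
  with M obtain c where c: "\<And>A. A \<in> sets borel \<Longrightarrow> emeasure lborel (M ` A) = c * emeasure lborel A"
    using emeasure_linear_image by blast
  have cont: "continuous_on S M" for S
    using M by (simp add: linear_continuous_on linear_conv_bounded_linear)
  have compact_L: "compact (ball_cyl V q + proj V ` K)" for q
    by (intro compact_set_plus compact_ball_cyl V compact_continuous_image continuous_on_proj K)
  have "ball_cyl V r \<subseteq> M ` ball_cyl V 1"
  proof
    fix d assume d: "d \<in> ball_cyl V r"
    \<comment> \<open>The preimage of \<open>d\<close> under \<open>M\<close>: its component in the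
      complement is stretched by \<open>1 / r\<close>.\<close>
    define x where "x = d + (1 / r - 1) *\<^sub>R proj V d"
    have px: "proj V x = (1 / r) *\<^sub>R proj V d"
      by (simp add: x_def proj_simps proj_proj[OF V] algebra_simps)
    have "M x = d + ((1 / r - 1) - (1 - r) * (1 / r)) *\<^sub>R proj V d"
      by (simp only: M_def px) (simp add: x_def algebra_simps)
    also have "(1 / r - 1) - (1 - r) * (1 / r) = 0" using r by (simp add: field_simps)
    finally have "M x = d" by simp
    moreover have "x \<bullet> v = d \<bullet> v" if "v \<in> V" for v
      using inner_proj_eq_0[OF V that] by (simp add: x_def inner_add_left)
    then have "x \<in> ball_cyl V 1"
      using d r by (auto simp: ball_cyl_def px)
    ultimately show "d \<in> M ` ball_cyl V 1" by blast
  qed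
  moreover have "M ` ball_cyl V 1 \<in> sets borel"
    by (intro borel_compact compact_continuous_image cont compact_ball_cyl V)
  ultimately have 1: "emeasure lborel (ball_cyl V r) \<le> c * emeasure lborel (ball_cyl V 1)"
    using compact_ball_cyl[OF V, of 1] by (simp add: c[symmetric] borel_compact emeasure_mono)
  obtain k where k: "k \<in> K" using K by blast
  \<comment> \<open>By convexity \<open>r *\<^sub>R k' + (1 - r) *\<^sub>R k\<close> stays in
    \<open>K\<close>, so one translation, given by a fixed \<open>k\<close>, moves the shrunken copy
    of the projection of \<open>K\<close> into that projection.\<close>
  have "(\<lambda>z. z + (1 - r) *\<^sub>R proj V k) ` M ` (ball_cyl V 1 + proj V ` K) \<subseteq> ball_cyl V r + proj V ` K"
  proof clarify
    fix z assume "z \<in> ball_cyl V 1 + proj V ` K"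
    then obtain d k' where d: "d \<in> ball_cyl V 1" and k': "k' \<in> K" and z: "z = d + proj V k'"
      unfolding set_plus_def by blast
    have "M d \<in> ball_cyl V r"
      using d r by (auto simp: ball_cyl_def Minner pM mult_left_le)
    moreover have "r *\<^sub>R k' + (1 - r) *\<^sub>R k \<in> K"
      using K(2) k k' r by (auto intro: convexD)
    moreover have "M z + (1 - r) *\<^sub>R proj V k = M d + proj V (r *\<^sub>R k' + (1 - r) *\<^sub>R k)"
      by (simp add: z M_def proj_simps proj_proj[OF V] algebra_simps)
    ultimately show "M z + (1 - r) *\<^sub>R proj V k \<in> ball_cyl V r + proj V ` K"
      by (metis imageI set_plus_intro)
  qed
  moreover have MB: "M ` (ball_cyl V 1 + proj V ` K) \<in> sets borel"
    by (intro borel_compact compact_continuous_image cont compact_L)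
  ultimately have "c * cyl_volume V K \<le> emeasure lborel (ball_cyl V r + proj V ` K)"
    using compact_L[of r] compact_L[of 1]
    by (simp add: cyl_volume_def c[symmetric] borel_compact emeasure_mono 
        flip: emeasure_lborel_translate[OF MB, of "(1 - r) *\<^sub>R proj V k"])
  then have "c * cyl_volume V K * emeasure lborel (ball_cyl V 1) 
      \<le> emeasure lborel (ball_cyl V r + proj V ` K) * emeasure lborel (ball_cyl V 1)"
    by (rule mult_right_mono) simp
  moreover have "emeasure lborel (ball_cyl V r) * cyl_volume V K 
      \<le> c * emeasure lborel (ball_cyl V 1) * cyl_volume V K"
    using 1 by (rule mult_right_mono) simp
  ultimately show ?thesis by (simp add: ac_simps)
qed

text \<open>A fibre parallel to \<open>w\<close> of the flattened sum is a translate of part of the fibre segment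
  contributed by the point of \<open>K\<close> whose projection is nearest.\<close>

lemma emeasure_flatten_le:
  assumes W: "orthonormal (insert w W)" "w \<notin> W" and K: "compact K" "K \<noteq> {}"
  shows "emeasure lborel (ball_cyl W 1 + proj (insert w W) ` K) \<le> cyl_volume W K"
proof -
  let ?V = "insert w W"
  note W0 = orthonormal_insertD[OF W(1)]
  note [simp] = orthonormal_insert_inner(1)[OF W] W0(2) inner_proj_insert[OF W]
  have pw: "proj ?V w = 0" "\<And>x. proj ?V x \<bullet> w = 0" "\<And>x v. v \<in> W \<Longrightarrow> proj ?V x \<bullet> v = 0"
    using proj_eq_0[OF W(1)] inner_proj_eq_0[OF W(1)] by blast+
  define X where "X = ball_cyl W 1 + proj W ` K"
  define X' where "X' = ball_cyl W 1 + proj ?V ` K"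
  have [measurable]: "X \<in> sets borel" "X' \<in> sets borel"
    unfolding X_def X'_def
    by (intro borel_compact compact_set_plus compact_ball_cyl W0 compact_continuous_image 
        continuous_on_proj K)+
  have shift: "\<exists>c. \<forall>t. y - (y \<bullet> w) *\<^sub>R w + t *\<^sub>R w \<in> X' \<longrightarrow> y - (y \<bullet> w) *\<^sub>R w + (t + c) *\<^sub>R w \<in> X" for y
  proof -
    \<comment> \<open>The nearest \<open>k\<close> depends on the line through \<open>y\<close> but
      not on \<open>t\<close>, so the single shift \<open>k \<bullet> w\<close> serves the whole
      fibre.\<close>
    have "continuous_on K (\<lambda>k. norm (proj ?V y - proj ?V k))"
      by (intro continuous_intros continuous_on_proj)
    then obtain k where k: "k \<in> K" 
      "\<And>k'. k' \<in> K \<Longrightarrow> norm (proj ?V y - proj ?V k) \<le> norm (proj ?V y - proj ?V k')"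
      using continuous_attains_inf[OF K] by blast
    show ?thesis
    proof (intro exI allI impI)
      fix t assume "y - (y \<bullet> w) *\<^sub>R w + t *\<^sub>R w \<in> X'"
      then obtain d k' where d: "d \<in> ball_cyl W 1" and k': "k' \<in> K" 
        and eq: "y - (y \<bullet> w) *\<^sub>R w + t *\<^sub>R w = d + proj ?V k'"
        unfolding X'_def set_plus_def by blast
      have dw: "d \<bullet> w = t"
        using arg_cong[OF eq, of "\<lambda>z. z \<bullet> w"] by (simp add: inner_add_left inner_diff_left pw)
      have pd: "proj ?V d = proj ?V y - proj ?V k'"
        using arg_cong[OF eq, of "proj ?V"] by (simp add: proj_simps pw proj_proj[OF W(1)])
      \<comment> \<open>Exchanging \<open>k'\<close> for \<open>k\<close> keeps the height
        \<open>t\<close>; by Pythagoras the ball part does not get longer.\<close>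
      define e where "e = d + proj ?V k' - proj ?V k"
      have "proj ?V e = proj ?V y - proj ?V k"
        by (simp add: e_def proj_simps proj_proj[OF W(1)] pd)
      moreover have "e \<bullet> w = t" by (simp add: e_def inner_add_left inner_diff_left pw dw)
      ultimately have "(norm (proj W e))\<^sup>2 \<le> (norm (proj W d))\<^sup>2"
        unfolding norm_proj_insert[OF W] using k(2)[OF k'] pd dw by (simp add: power_mono)
      then have "norm (proj W e) \<le> norm (proj W d)" by (rule power2_le_imp_le) simp
      moreover have "e \<bullet> v = d \<bullet> v" if "v \<in> W" for v
        using that by (simp add: e_def inner_add_left inner_diff_left pw)
      ultimately have "e \<in> ball_cyl W 1" using d by (auto simp: ball_cyl_def)
      then have "e + proj W k \<in> X" unfolding X_def using k(1) by blast
      moreover have "y - (y \<bullet> w) *\<^sub>R w + (t + k \<bullet> w) *\<^sub>R w = d + proj ?V k' + (k \<bullet> w) *\<^sub>R w"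
        unfolding eq[symmetric] by (simp add: algebra_simps)
      then have "y - (y \<bullet> w) *\<^sub>R w + (t + k \<bullet> w) *\<^sub>R w = e + proj W k"
        by (simp add: e_def proj_insert[OF W, of k])
      ultimately show "y - (y \<bullet> w) *\<^sub>R w + (t + k \<bullet> w) *\<^sub>R w \<in> X" by simp
    qed
  qed
  have "(\<integral>\<^sup>+t. indicator X' (y - (y \<bullet> w) *\<^sub>R w + t *\<^sub>R w) \<partial>lborel)
     \<le> (\<integral>\<^sup>+t. indicator X (y - (y \<bullet> w) *\<^sub>R w + t *\<^sub>R w) \<partial>lborel)" for y
  proof -
    obtain c where "\<And>t. y - (y \<bullet> w) *\<^sub>R w + t *\<^sub>R w \<in> X' \<Longrightarrow> y - (y \<bullet> w) *\<^sub>R w + (t + c) *\<^sub>R w \<in> X"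
      using shift[of y] by blast
    then have "(\<integral>\<^sup>+t. indicator X' (y - (y \<bullet> w) *\<^sub>R w + t *\<^sub>R w) \<partial>lborel)
       \<le> (\<integral>\<^sup>+t. indicator X (y - (y \<bullet> w) *\<^sub>R w + (t + c) *\<^sub>R w) \<partial>lborel)"
      by (intro nn_integral_mono) (simp split: split_indicator)
    also have "\<dots> = (\<integral>\<^sup>+t. indicator X (y - (y \<bullet> w) *\<^sub>R w + t *\<^sub>R w) \<partial>lborel)"
      by (rule nn_integral_lborel_translate) simp
    finally show ?thesis .
  qed
  then have "emeasure lborel X' \<le> emeasure lborel X"
    unfolding emeasure_eq_integral_fibres[OF W0(3) \<open>X \<in> sets borel\<close>] 
       emeasure_eq_integral_fibres[OF W0(3) \<open>X' \<in> sets borel\<close>]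
    by - (rule nn_integral_mono, simp add: nn_integral_cmult mult_left_mono)
  then show ?thesis by (simp add: X_def X'_def cyl_volume_def)
qed

text \<open>Comparing the slices at height \<open>t\<close> orthogonal to \<open>w\<close>, which are cylinders over balls of radius
  \<open>sqrt (1 - t\<^sup>2)\<close>.\<close>

lemma cyl_volume_insert_le:
  assumes W: "orthonormal (insert w W)" "w \<notin> W" and K: "compact K" "convex K" "K \<noteq> {}"
  shows "cyl_volume (insert w W) K * emeasure lborel (ball_cyl W 1)
       \<le> cyl_volume W K * emeasure lborel (ball_cyl (insert w W) 1)"
proof -
  let ?V = "insert w W"
  note W0 = orthonormal_insertD[OF W(1)]
  note [simp] = orthonormal_insert_inner(1)[OF W] W0(2) inner_proj_insert[OF W]
  have pw: "proj ?V w = 0" "\<And>x. proj ?V x \<bullet> w = 0" "\<And>x v. v \<in> W \<Longrightarrow> proj ?V x \<bullet> v = 0"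
    using proj_eq_0[OF W(1)] inner_proj_eq_0[OF W(1)] by blast+
  define C where "C = {y. 0 \<le> y \<bullet> w \<and> y \<bullet> w \<le> 1}"
  \<comment> \<open>\<open>p t\<close> moves points along \<open>w\<close> to height
    \<open>t\<close>. \<open>S X t\<close> is the volume of the slice of \<open>X\<close> at that
    height, thickened to the unit slab \<open>C\<close>; it arises by swapping the integrals in the
    fibre formula.\<close>
  define p where "p t y = y - (y \<bullet> w) *\<^sub>R w + t *\<^sub>R w" for t y
  define S where "S X t = (\<integral>\<^sup>+y. indicator C y * indicator X (p t y) \<partial>lborel)" for X and t :: real
  have [measurable]: "C \<in> sets borel" unfolding C_def by measurable
  have slices: "emeasure lborel X = (\<integral>\<^sup>+t. S X t \<partial>lborel)" and S_meas: "S X \<in> borel_measurable lborel" 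
    and S_eq: "S X t = emeasure lborel {y \<in> C. p t y \<in> X}"
    and S_sets: "{y \<in> C. p t y \<in> X} \<in> sets borel"
    if [measurable]: "X \<in> sets borel" for X t
  proof -
    show "emeasure lborel X = (\<integral>\<^sup>+t. S X t \<partial>lborel)"
      unfolding emeasure_eq_integral_fibres[OF W0(3) \<open>X \<in> sets borel\<close>] S_def C_def[symmetric] p_def
      by (rule lborel_pair.Fubini') simp
    show "S X \<in> borel_measurable lborel"
      unfolding S_def p_def by measurable
    show sets: "{y \<in> C. p t y \<in> X} \<in> sets borel"
      unfolding p_def by measurable
    have "S X t = (\<integral>\<^sup>+y. indicator {y \<in> C. p t y \<in> X} y \<partial>lborel)"
      unfolding S_def by (intro nn_integral_cong) (simp split: split_indicator)
    then show "S X t = emeasure lborel {y \<in> C. p t y \<in> X}" using sets by simp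
  qed
  have norm_p: "(norm (proj W (p t y)))\<^sup>2 = (norm (proj ?V y))\<^sup>2 + t\<^sup>2" for t y
  proof -
    have "proj ?V (p t y) = proj ?V y" by (simp add: p_def proj_simps pw)
    moreover have "p t y \<bullet> w = t" by (simp add: p_def inner_add_left inner_diff_left)
    ultimately show ?thesis unfolding norm_proj_insert[OF W] by simp
  qed
  have inner_p: "p t y \<bullet> v = y \<bullet> v" if "v \<in> W" for t y v
    using that by (simp add: p_def inner_add_left inner_diff_left)
  have p_in: "p t y \<in> ball_cyl W 1 \<longleftrightarrow> (\<forall>v\<in>W. 0 \<le> y \<bullet> v \<and> y \<bullet> v \<le> 1) \<and> (norm (proj ?V y))\<^sup>2 + t\<^sup>2 \<le> 1" for t y
    using abs_square_le_1[of "norm (proj W (p t y))"] norm_p[of t y] by (auto simp: ball_cyl_def inner_p)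
  define X where "X = ball_cyl W 1 + proj ?V ` K"
  have XB: "X \<in> sets borel"
    unfolding X_def by (intro borel_compact compact_set_plus compact_ball_cyl W0 compact_continuous_image 
        continuous_on_proj K)
  have BB: "ball_cyl W 1 \<in> sets borel"
    by (intro borel_compact compact_ball_cyl W0)
  \<comment> \<open>At \<open>t = 1\<close> and \<open>t = -1\<close> the radius is 0 and the
    shrinking map is not invertible. These two heights form a null set; beyond them the slices of
    the ball cylinder are empty.\<close>
  have slice: "cyl_volume ?V K * S (ball_cyl W 1) t \<le> S X t * emeasure lborel (ball_cyl ?V 1)"
    if "t \<noteq> 1" "t \<noteq> -1" for t
  proof (cases "\<bar>t\<bar> < 1")
    case True
    define r where "r = sqrt (1 - t\<^sup>2)"
    have t: "t\<^sup>2 < 1" using True by (simp add: abs_square_less_1)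
    then have r: "0 < r" "r \<le> 1" "r\<^sup>2 = 1 - t\<^sup>2" by (auto simp: r_def)
    have *: "norm (proj ?V y) \<le> r \<longleftrightarrow> (norm (proj ?V y))\<^sup>2 + t\<^sup>2 \<le> 1" for y
      using abs_le_square_iff[of "norm (proj ?V y)" r] r by auto
    have "{y \<in> C. p t y \<in> ball_cyl W 1} \<subseteq> ball_cyl ?V r"
      by (auto simp: p_in C_def ball_cyl_def[of ?V] *)
    then have 1: "S (ball_cyl W 1) t \<le> emeasure lborel (ball_cyl ?V r)"
      unfolding S_eq[OF BB] by (intro emeasure_mono) (simp_all add: borel_compact compact_ball_cyl W(1))
    have "ball_cyl ?V r + proj ?V ` K \<subseteq> {y \<in> C. p t y \<in> X}"
    proof
      fix y assume "y \<in> ball_cyl ?V r + proj ?V ` K"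
      then obtain d k where d: "d \<in> ball_cyl ?V r" and k: "k \<in> K" and y: "y = d + proj ?V k"
        unfolding set_plus_def by blast
      have yw: "y \<bullet> w = d \<bullet> w" by (simp add: y inner_add_left pw)
      have "p t d \<in> ball_cyl W 1" using d by (auto simp: p_in ball_cyl_def[of ?V] *)
      moreover have "p t y = p t d + proj ?V k"
        unfolding p_def yw by (simp add: y)
      ultimately have "p t y \<in> X" unfolding X_def using k by auto
      moreover have "y \<in> C" using d by (simp add: C_def yw ball_cyl_def)
      ultimately show "y \<in> {y \<in> C. p t y \<in> X}" by blast
    qed
    then have 2: "emeasure lborel (ball_cyl ?V r + proj ?V ` K) \<le> S X t"
      unfolding S_eq[OF XB] using S_sets[OF XB] by (intro emeasure_mono) auto
    have "cyl_volume ?V K * S (ball_cyl W 1) t \<le> emeasure lborel (ball_cyl ?V r) * cyl_volume ?V K"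
      using mult_left_mono[OF 1, of "cyl_volume ?V K"] by (simp add: mult.commute)
    also have "\<dots> \<le> emeasure lborel (ball_cyl ?V r + proj ?V ` K) * emeasure lborel (ball_cyl ?V 1)"
      by (rule emeasure_ball_cyl_shrink[OF W(1) K r(1,2)])
    also have "\<dots> \<le> S X t * emeasure lborel (ball_cyl ?V 1)"
      by (intro mult_right_mono 2) simp
    finally show ?thesis .
  next
    case False
    then have "t\<^sup>2 > 1" using that by (metis abs_square_less_1 abs_square_eq_1 linorder_neqE_linordered_idom abs_1 power2_eq_iff one_power2)
    have "p t y \<notin> ball_cyl W 1" for y
      using \<open>t\<^sup>2 > 1\<close> zero_le_power2[of "norm (proj ?V y)"] unfolding p_in by linarith
    then have "S (ball_cyl W 1) t = 0" by (simp add: S_def)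
    then show ?thesis by simp
  qed
  have "cyl_volume ?V K * emeasure lborel (ball_cyl W 1) = (\<integral>\<^sup>+t. cyl_volume ?V K * S (ball_cyl W 1) t \<partial>lborel)"
    unfolding slices[OF BB] using S_meas[OF BB] by (simp add: nn_integral_cmult)
  also have "\<dots> \<le> (\<integral>\<^sup>+t. S X t * emeasure lborel (ball_cyl ?V 1) \<partial>lborel)"
    using AE_lborel_singleton[of 1] AE_lborel_singleton[of "-1"]
    by (intro nn_integral_mono_AE, eventually_elim) (use slice in auto)
  also have "\<dots> = emeasure lborel X * emeasure lborel (ball_cyl ?V 1)"
    unfolding slices[OF XB] using S_meas[OF XB] by (simp add: nn_integral_multc)
  also have "\<dots> \<le> cyl_volume W K * emeasure lborel (ball_cyl ?V 1)"
    unfolding X_def by (intro mult_right_mono emeasure_flatten_le W K) simp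
  finally show ?thesis .
qed

text \<open>Each further direction can only lower the ratio of \<open>cyl_volume W K\<close> to the
  volume of \<open>ball_cyl W 1\<close>, and for \<open>W = {}\<close> both sides agree.\<close>

lemma cyl_volume_le:
  assumes W: "orthonormal W" and K: "compact K" "convex K" "K \<noteq> {}"
  shows "cyl_volume W K * emeasure lborel (cball (0::'a) 1)
       \<le> emeasure lborel (cball (0::'a::euclidean_space) 1 + K) * emeasure lborel (ball_cyl W 1)"
proof -
  have "finite W" using W by (simp add: orthonormal_def)
  then show ?thesis using W
  proof (induction W rule: finite_induct)
    case empty
    then show ?case by (simp add: cyl_volume_def)
  next
    case (insert w W)
    let ?V = "insert w W" and ?e = "emeasure lborel (cball (0::'a) 1)"
    let ?D = "emeasure lborel (ball_cyl W 1)" and ?D' = "emeasure lborel (ball_cyl (insert w W) 1)"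
    let ?E = "emeasure lborel (cball (0::'a) 1 + K)"
    note W0 = orthonormal_insertD(1)[OF insert.prems]
    \<comment> \<open>The factor \<open>?D\<close> links the one-direction inequality to the
      induction hypothesis; being positive and finite, it is cancelled at the end.\<close>
    have "?D * (cyl_volume ?V K * ?e) = (cyl_volume ?V K * ?D) * ?e"
      by (simp add: ac_simps)
    also have "\<dots> \<le> (cyl_volume W K * ?D') * ?e"
      by (intro mult_right_mono cyl_volume_insert_le insert K) simp
    also have "\<dots> = (cyl_volume W K * ?e) * ?D'"
      by (simp add: ac_simps)
    also have "\<dots> \<le> (?E * ?D) * ?D'"
      by (intro mult_right_mono insert.IH W0) simp
    also have "\<dots> = ?D * (?E * ?D')"
      by (simp add: ac_simps)
    finally show ?case
      using emeasure_ball_cyl_pos[OF W0] emeasure_compact_finite[OF compact_ball_cyl[OF W0]]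
      by (subst (asm) ennreal_mult_le_mult_iff) (auto simp: less_top)
  qed
qed

section \<open>The inequality for zonotopes, from the unit ball to ellipsoids\<close>

lemma compact_convex_sum_segments:
  assumes "finite I"
  shows "compact (\<Sum>i\<in>I. closed_segment (a i) (b i :: 'a::euclidean_space)) \<and> 
     convex (\<Sum>i\<in>I. closed_segment (a i) (b i)) \<and> (\<Sum>i\<in>I. closed_segment (a i) (b i)) \<noteq> {}"
  using assms
proof (induction I rule: finite_induct)
  case (insert j I)
  then show ?case
    by (auto intro!: compact_set_plus convex_set_plus)
qed auto

text \<open>Splitting off a segment expands both sides with the same coefficient, and the induction
  hypothesis applies to each term. It must hold for all \<open>W\<close>, since the second term
  involves another orthonormal set. With no segments left, this is the ratio inequality.\<close>

lemma cyl_volume_sum_segments_le: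
  assumes "finite I" and W: "orthonormal W" and K: "compact K" "convex K" "K \<noteq> {}"
  shows "cyl_volume W (K + (\<Sum>i\<in>I. closed_segment (a i) (b i))) * emeasure lborel (cball (0::'a) 1)
       \<le> emeasure lborel (cball (0::'a::euclidean_space) 1 + K)
          * cyl_volume W (\<Sum>i\<in>I. closed_segment (a i) (b i))"
  using assms(1,2)
proof (induction I arbitrary: W rule: finite_induct)
  case empty
  then show ?case
    using cyl_volume_le[OF _ K] by (simp add: cyl_volume_def[of _ "{0}"] cyl_volume_def[of _ 0])
next
  case (insert j I)
  let ?S = "\<Sum>i\<in>I. closed_segment (a i) (b i)"
  let ?e = "emeasure lborel (cball (0::'a) 1)" and ?E = "emeasure lborel (cball (0::'a) 1 + K)"
  obtain s W' where W': "orthonormal W'" and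
    *: "\<And>A. compact A \<Longrightarrow> convex A \<Longrightarrow>
        cyl_volume W (A + closed_segment (a j) (b j)) = cyl_volume W A + s * cyl_volume W' A"
    using cyl_volume_plus_segment[OF insert.prems, of "a j" "b j"] by blast
  note S = compact_convex_sum_segments[OF insert.hyps(1), of a b]
  have KS: "compact (K + ?S)" "convex (K + ?S)"
    using S K by (auto intro!: compact_set_plus convex_set_plus)
  have "cyl_volume W (K + (closed_segment (a j) (b j) + ?S)) * ?e 
      = cyl_volume W (K + ?S + closed_segment (a j) (b j)) * ?e"
    by (simp add: ac_simps)
  also have "\<dots> = cyl_volume W (K + ?S) * ?e + s * (cyl_volume W' (K + ?S) * ?e)"
    by (simp only: *[OF KS] distrib_right mult.assoc)
  also have "\<dots> \<le> ?E * cyl_volume W ?S + s * (?E * cyl_volume W' ?S)"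
    by (intro add_mono mult_left_mono insert.IH insert.prems W') simp
  also have "\<dots> = ?E * cyl_volume W (?S + closed_segment (a j) (b j))"
  proof -
    have "cyl_volume W (?S + closed_segment (a j) (b j)) = cyl_volume W ?S + s * cyl_volume W' ?S"
      using S by (intro *) auto
    then show ?thesis by (simp only: distrib_left mult.left_commute)
  qed
  finally show ?case
    using insert.hyps by (simp add: ac_simps)
qed

lemma zonotope_compact_convex:
  assumes "zonotope Z"
  shows "compact Z" "convex Z" "Z \<noteq> {}"
proof -
  obtain I :: "nat set" and a b where "finite I" "Z = (\<Sum>i\<in>I. closed_segment (a i) (b i))"
    using assms unfolding zonotope_def by blast
  then show "compact Z" "convex Z" "Z \<noteq> {}"
    using compact_convex_sum_segments[of I a b] by auto
qed

lemma zonotope_linear_image: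
  assumes S: "linear S" and "zonotope Z"
  shows "zonotope (S ` Z)"
proof -
  obtain I :: "nat set" and a b where I: "finite I" and Z: "Z = (\<Sum>i\<in>I. closed_segment (a i) (b i))"
    using assms(2) unfolding zonotope_def by blast
  have "S ` (\<Sum>i\<in>I. closed_segment (a i) (b i)) = (\<Sum>i\<in>I. closed_segment (S (a i)) (S (b i)))"
    using I
    by (induction I rule: finite_induct)
       (auto simp: linear_image_set_plus[OF S] closed_segment_linear_image[OF S] linear_0[OF S])
  then show ?thesis unfolding zonotope_def Z
    by (intro exI[of _ I] exI[of _ "\<lambda>i. S (a i)"] exI[of _ "\<lambda>i. S (b i)"]) (simp add: I)
qed

lemma emeasure_ball_zonotope_le:
  fixes K Z :: "'a::euclidean_space set"
  assumes K: "compact K" "convex K" "K \<noteq> {}" and Z: "zonotope Z"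
  shows "emeasure lborel (cball (0::'a) 1) * emeasure lborel (cball 0 1 + (K + Z))
       \<le> emeasure lborel (cball 0 1 + K) * emeasure lborel (cball 0 1 + Z)"
proof -
  obtain I :: "nat set" and a b where I: "finite I" and "Z = (\<Sum>i\<in>I. closed_segment (a i) (b i))"
    using Z unfolding zonotope_def by blast
  then show ?thesis
    using cyl_volume_sum_segments_le[OF I orthonormal_empty K, of a b]
    by (simp add: cyl_volume_def mult.commute)
qed

lemma emeasure_compact_eq_measure:
  fixes A :: "'a::euclidean_space set"
  assumes "compact A"
  shows "emeasure lborel A = ennreal (measure lebesgue A)"
  using emeasure_compact_finite[OF assms] borel_compact[OF assms]
  by (simp add: emeasure_eq_ennreal_measure less_top measure_completion)

text \<open>If \<open>T\<close> is singular, \<open>B\<close> is a null set and the left side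
  vanishes. Otherwise pulling back by the inverse \<open>S\<close> makes \<open>B\<close> a unit
  ball and scales every volume by the same \<open>k\<close>; each side is a product of two volumes
  and gains \<open>k * k\<close>.\<close>

lemma measure_ellipsoid_zonotope_le:
  fixes K B Z :: "'a::euclidean_space set"
  assumes K: "compact K" "convex K" "K \<noteq> {}" and B: "ellipsoid B" and Z: "zonotope Z"
  shows "measure lebesgue B * measure lebesgue (B + (K + Z))
       \<le> measure lebesgue (B + K) * measure lebesgue (B + Z)"
proof -
  obtain T c where T: "linear T" and B: "B = (\<lambda>x. T x + c) ` cball (0::'a) 1"
    using B unfolding ellipsoid_def by blast
  have B': "B = (\<lambda>x. x + c) ` T ` cball 0 1"
    by (simp add: B image_image)
  have contT: "continuous_on A T" for A
    using T by (simp add: linear_continuous_on linear_conv_bounded_linear)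
  have compact_B: "compact B"
    unfolding B by (intro compact_continuous_image continuous_intros contT compact_cball)
  note Z' = zonotope_compact_convex[OF Z]
  show ?thesis
  proof (cases "inj T")
    case False
    have "negligible (T ` cball 0 1)"
      by (rule negligible_linear_singular_image[OF T False])
    then have "negligible B"
      unfolding B' by (metis (no_types, lifting) add.commute image_cong negligible_translation)
    then have "measure lebesgue B = 0"
      by (rule negligible_imp_measure0)
    then show ?thesis by simp
  next
    case True
    obtain S where S: "linear S" "\<And>x. T (S x) = x"
      using linear_injective_isomorphism[OF T True] by blast
    have contS: "continuous_on A S" for A
      using S by (simp add: linear_continuous_on linear_conv_bounded_linear)
    obtain k where k: "\<And>A. A \<in> sets borel \<Longrightarrow> emeasure lborel (T ` A) = k * emeasure lborel A"
      using emeasure_linear_image[OF T True] by blast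
    have *: "emeasure lborel (B + A) = k * emeasure lborel (cball 0 1 + S ` A)" if A: "compact A" for A
    proof -
      have "A = T ` S ` A" by (simp add: image_image S)
      then have "B + A = (\<lambda>x. x + c) ` (A + T ` cball 0 1)"
        unfolding B' by (simp add: set_plus_translate add.commute)
      also have "A + T ` cball 0 1 = T ` (cball 0 1 + S ` A)"
        using \<open>A = T ` S ` A\<close> by (simp add: linear_image_set_plus[OF T] add.commute)
      finally have eq: "B + A = (\<lambda>x. x + c) ` T ` (cball 0 1 + S ` A)" .
      have "compact (cball 0 1 + S ` A)"
        by (intro compact_set_plus compact_cball compact_continuous_image contS A)
      then show ?thesis
        unfolding eq by (simp add: emeasure_lborel_translate k borel_compact compact_continuous_image contT)
    qed
    have KZ: "compact (K + Z)" by (intro compact_set_plus K Z')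
    \<comment> \<open>The scaling rule for \<open>B + A\<close> with \<open>A = {0}\<close>.\<close>
    have "emeasure lborel B = k * emeasure lborel (cball (0::'a) 1)"
      using *[of "{0}"] by (simp add: linear_0[OF S(1)])
    then have "emeasure lborel B * emeasure lborel (B + (K + Z)) =
        k * k * (emeasure lborel (cball (0::'a) 1) * emeasure lborel (cball 0 1 + (S ` K + S ` Z)))"
      by (simp add: *[OF KZ] linear_image_set_plus[OF S(1)] ac_simps)
    also have "\<dots> \<le> k * k * (emeasure lborel (cball 0 1 + S ` K) * emeasure lborel (cball 0 1 + S ` Z))"
      using K by (intro mult_left_mono emeasure_ball_zonotope_le zonotope_linear_image S Z
         compact_continuous_image contS convex_linear_image) auto
    also have "\<dots> = emeasure lborel (B + K) * emeasure lborel (B + Z)"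
      by (simp add: *[OF K(1)] *[OF Z'(1)] ac_simps)
    finally show ?thesis
      using compact_B K(1) Z'(1) KZ 
      by (simp add: emeasure_compact_eq_measure compact_set_plus flip: ennreal_mult)
  qed
qed

section \<open>Passing from zonotopes to zonoids\<close>

text \<open>Continuity of measure from above: the closed neighbourhoods decrease, have finite
  volume, and intersect in \<open>A\<close> because \<open>A\<close> is closed.\<close>

lemma measure_plus_cball_tendsto:
  fixes A :: "'a::euclidean_space set"
  assumes A: "compact A"
  shows "(\<lambda>n. measure lebesgue (A + cball 0 (1 / Suc n))) \<longlonglongrightarrow> measure lebesgue A"
proof -
  have cmp: "compact (A + cball 0 r)" for r
    by (intro compact_set_plus A compact_cball)
  have "(\<Inter>n. A + cball 0 (1 / Suc n)) = A"
  proof (intro equalityI subsetI)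
    fix x assume x: "x \<in> (\<Inter>n. A + cball 0 (1 / Suc n))"
    have le: "infdist x A \<le> 1 / Suc n" and "A \<noteq> {}" for n
    proof -
      have "x \<in> A + cball 0 (1 / Suc n)" using x by blast
      then obtain a b where ab: "a \<in> A" "norm b \<le> 1 / Suc n" "x = a + b"
        by (auto simp: set_plus_def)
      then have "infdist x A \<le> dist x a" by (intro infdist_le)
      then show "infdist x A \<le> 1 / Suc n" "A \<noteq> {}" using ab by (auto simp: dist_norm)
    qed
    have "infdist x A \<le> 0"
    proof (rule field_le_epsilon)
      fix e :: real assume "e > 0"
      then obtain n where "1 / Suc n < e" using nat_approx_posE by metis
      then show "infdist x A \<le> 0 + e" using le[of n] by simp
    qed
    then have "infdist x A = 0" using infdist_nonneg[of x A] by simp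
    then show "x \<in> A"
      using in_closed_iff_infdist_zero[OF compact_imp_closed[OF A] \<open>A \<noteq> {}\<close>] by simp
  next
    fix x assume "x \<in> A"
    then have "x + 0 \<in> A + cball 0 (1 / Suc n)" for n by (intro set_plus_intro) auto
    then show "x \<in> (\<Inter>n. A + cball 0 (1 / Suc n))" by simp
  qed
  moreover have "(\<lambda>n. measure lborel (A + cball 0 (1 / Suc n))) 
      \<longlonglongrightarrow> measure lborel (\<Inter>n. A + cball 0 (1 / Suc n))"
  proof (rule Lim_measure_decseq)
    show "range (\<lambda>n. A + cball 0 (1 / Suc n)) \<subseteq> sets lborel"
      using borel_compact[OF cmp] by auto
    show "decseq (\<lambda>n. A + cball 0 (1 / Suc n))"
      unfolding decseq_def by (intro allI impI set_plus_mono2 order_refl cball_subset_cball_iff[THEN iffD2])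
        (simp add: frac_le)
    show "emeasure lborel (A + cball 0 (1 / Suc n)) \<noteq> \<infinity>" for n
      using emeasure_compact_finite[OF cmp] by (simp add: less_top)
  qed
  ultimately show ?thesis
    using borel_compact[OF A] borel_compact[OF cmp] by (simp add: measure_completion)
qed

lemma infdist_less_imp_subset:
  fixes A B :: "'a::euclidean_space set"
  assumes A: "compact A" "A \<noteq> {}" and B: "compact B" "B \<noteq> {}" and less: "(SUP a\<in>A. infdist a B) < e"
  shows "A \<subseteq> B + cball 0 e"
proof
  fix x assume x: "x \<in> A"
  have "compact ((\<lambda>a. infdist a B) ` A)"
    by (intro compact_continuous_image continuous_intros A)
  \<comment> \<open>A real supremum bounds its members only if the set is bounded above; compactness
    of \<open>A\<close> ensures this.\<close>
  then have "bdd_above ((\<lambda>a. infdist a B) ` A)"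
    by (intro bounded_imp_bdd_above compact_imp_bounded)
  then have "infdist x B < e"
    using cSUP_upper[OF x] less by fastforce
  moreover obtain y where "y \<in> B" "infdist x B = dist x y"
    using infdist_attains_inf[OF compact_imp_closed[OF B(1)] B(2)] by metis
  ultimately have "y + (x - y) \<in> B + cball 0 e"
    by (intro set_plus_intro) (auto simp: dist_norm norm_minus_commute)
  then show "x \<in> B + cball 0 e" by simp
qed

text \<open>A single zonotope provides both inclusions: the first replaces \<open>Z\<close> by
  \<open>Y\<close> in the larger sum, the second returns from \<open>Y\<close> to \<open>Z\<close>
  on the right.\<close>

lemma zonoid_approx:
  fixes Z :: "'a::euclidean_space set"
  assumes "zonoid Z" and "e > 0"
  obtains Y where "zonotope Y" "Z \<subseteq> Y + cball 0 e" "Y \<subseteq> Z + cball 0 e"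
proof -
  obtain Zs where Z: "compact Z" "Z \<noteq> {}" and Zs: "\<And>k::nat. zonotope (Zs k)"
    and lim: "(\<lambda>k. hausdorff_distance (Zs k) Z) \<longlonglongrightarrow> 0"
    using assms(1) unfolding zonoid_def by blast
  have "eventually (\<lambda>k. hausdorff_distance (Zs k) Z < e) sequentially"
    using lim \<open>e > 0\<close> by (rule order_tendstoD)
  then obtain k where "hausdorff_distance (Zs k) Z < e"
    using eventually_happens'[OF sequentially_bot] by blast
  then have "(SUP a\<in>Zs k. infdist a Z) < e" "(SUP b\<in>Z. infdist b (Zs k)) < e"
    by (auto simp: hausdorff_distance_def)
  then show ?thesis
    using that[OF Zs[of k]] infdist_less_imp_subset Z zonotope_compact_convex[OF Zs[of k]] by metis
qed

theorem theorem4p12: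
  fixes K B Z :: "'a::euclidean_space set"
  assumes "convex_body K" and "ellipsoid B" and "zonoid Z"
  shows "measure lebesgue B * measure lebesgue (B + K + Z)
           \<le> measure lebesgue (B + K) * measure lebesgue (B + Z)"
proof -
  have K: "compact K" "convex K" "K \<noteq> {}"
    using assms(1) by (auto simp: convex_body_def)
  have Z: "compact Z" using assms(3) by (simp add: zonoid_def)
  obtain T c where T: "linear T" and B: "B = (\<lambda>x. T x + c) ` cball (0::'a) 1"
    using assms(2) unfolding ellipsoid_def by blast
  have compact_B: "compact B"
    unfolding B using T
    by (intro compact_continuous_image continuous_intros compact_cball) 
       (simp add: linear_continuous_on linear_conv_bounded_linear)
  have mono: "measure lebesgue X \<le> measure lebesgue Y" if "X \<subseteq> Y" "compact X" "compact Y" 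
    for X Y :: "'a set"
    using that by (intro measure_mono_fmeasurable fmeasurableD lmeasurable_compact)
  have bound: "measure lebesgue B * measure lebesgue (B + K + Z)
      \<le> measure lebesgue (B + K + cball 0 e) * measure lebesgue (B + Z + cball 0 e)"
    if "e > 0" for e
  proof -
    obtain Y where Y: "zonotope Y" "Z \<subseteq> Y + cball 0 e" "Y \<subseteq> Z + cball 0 e"
      using zonoid_approx[OF assms(3) \<open>e > 0\<close>] by blast
    note Y' = zonotope_compact_convex[OF Y(1)]
    \<comment> \<open>The error made in replacing \<open>Z\<close> by \<open>Y\<close> is absorbed
      into the convex body, to which the zonotope inequality applies as well.\<close>
    let ?K = "K + cball 0 e"
    obtain k where "k \<in> K" using K(3) by blast
    then have "k + 0 \<in> ?K" using \<open>e > 0\<close> by (intro set_plus_intro) auto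
    then have K': "compact ?K" "convex ?K" "?K \<noteq> {}"
      using K by (auto intro!: compact_set_plus convex_set_plus)
    have "B + K + Z \<subseteq> B + K + (Y + cball 0 e)"
      using Y(2) by (intro set_plus_mono2 order_refl)
    also have "\<dots> = B + (?K + Y)" by (simp add: ac_simps)
    finally have "measure lebesgue (B + K + Z) \<le> measure lebesgue (B + (?K + Y))"
      by (rule mono) (intro compact_set_plus compact_B K K' Z Y')+
    then have "measure lebesgue B * measure lebesgue (B + K + Z) 
        \<le> measure lebesgue B * measure lebesgue (B + (?K + Y))"
      by (intro mult_left_mono) auto
    also have "\<dots> \<le> measure lebesgue (B + ?K) * measure lebesgue (B + Y)"
      by (rule measure_ellipsoid_zonotope_le[OF K' assms(2) Y(1)])
    also have "\<dots> \<le> measure lebesgue (B + ?K) * measure lebesgue (B + (Z + cball 0 e))"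
      using Y(3) by (intro mult_left_mono mono set_plus_mono2 order_refl compact_set_plus 
          compact_B Y' Z compact_cball) auto
    finally show ?thesis by (simp add: add.assoc)
  qed
  \<comment> \<open>The left side of \<open>bound\<close> does not depend on \<open>e\<close>, so it
    survives the limit along \<open>e = 1 / Suc n\<close>.\<close>
  have "(\<lambda>n. measure lebesgue (B + K + cball 0 (1 / Suc n)) * measure lebesgue (B + Z + cball 0 (1 / Suc n)))
      \<longlonglongrightarrow> measure lebesgue (B + K) * measure lebesgue (B + Z)"
    by (intro tendsto_mult measure_plus_cball_tendsto compact_set_plus compact_B K Z)
  then show ?thesis
    by (rule tendsto_lowerbound) (auto intro!: always_eventually bound)
qed

end
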